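(* Let $0<\alpha\le 1$ and let $M$ be a random variable with values in $\{0,1,2,\dots\}$ and probability generating function $P(s)$ such that $$\lim_{s\to1^-}\frac{1-P(s)}{(1-s)^\alpha}=\lambda>0.$$ For $0<p<1$, let $\{Y_j\}$ be a sequence of i.i.d. Bernoulli variables with parameter $b=p^{1/\alpha}$, independent of $M$, and put $X=\sum_{j=1}^{M}Y_j$. Let $\{X_i\}$ be a sequence of independent copies of $X$ and define $S_N=\sum_{i=1}^{N}X_i$, where $N$ is a geometric($p$) variable independent of $\{X_i\}$. Then, as $p\to0$, $S_N$ converges in law to a discrete Mittag-Leffler (DML) variable.
   Context: A geometric($p$) variable has probability generating function $ps/(1-qs)$, $q=1-p$. A random variable has a discrete Mittag-Leffler distribution $\mathrm{DML}(\lambda,\alpha)$, $\lambda>0$, $0<\alpha\le1$, if its probability generating function is $[1+\lambda(1-s)^\alpha]^{-1}$. An empty sum is $0$. *)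

theory Defs
  imports "HOL-Probability.Probability"
begin

definition pgf :: "'a measure \<Rightarrow> ('a \<Rightarrow> nat) \<Rightarrow> real \<Rightarrow> real" where
  "pgf \<Omega> Z s = (\<integral>\<omega>. s ^ Z \<omega> \<partial>\<Omega>)"

(* The pgf p s / (1 - (1 - p) s) belongs to the geometric law supported on {1, 2, ...},
   whereas the library's geometric_pmf lives on {0, 1, ...}. *)
definition geometric_var :: "'a measure \<Rightarrow> ('a \<Rightarrow> nat) \<Rightarrow> real \<Rightarrow> bool" where
  "geometric_var \<Omega> Z p \<longleftrightarrow>
     Z \<in> measurable \<Omega> (count_space UNIV) \<and> 0 < p \<and> p < 1 \<and>
     (\<forall>s. \<bar>s\<bar> \<le> 1 \<longrightarrow> pgf \<Omega> Z s = p * s / (1 - (1 - p) * s))"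

(* DML(c, \<alpha>); c is the parameter usually written lambda. *)
definition DML_var :: "'a measure \<Rightarrow> ('a \<Rightarrow> nat) \<Rightarrow> real \<Rightarrow> real \<Rightarrow> bool" where
  "DML_var \<Omega> Z c \<alpha> \<longleftrightarrow>
     Z \<in> measurable \<Omega> (count_space UNIV) \<and> 0 < c \<and> 0 < \<alpha> \<and> \<alpha> \<le> 1 \<and>
     (\<forall>s. \<bar>s\<bar> \<le> 1 \<longrightarrow> pgf \<Omega> Z s = inverse (1 + c * (1 - s) powr \<alpha>))"

(* Sequences are indexed from 1; the entry at index 0 is irrelevant. *)
definition iid_seq :: "'a measure \<Rightarrow> (nat \<Rightarrow> 'a \<Rightarrow> nat) \<Rightarrow> nat measure \<Rightarrow> bool" where
  "iid_seq \<Omega> Z D \<longleftrightarrow>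
     prob_space.indep_vars \<Omega> (\<lambda>_. count_space UNIV) Z {1..} \<and>
     (\<forall>j\<ge>1. distr \<Omega> (count_space UNIV) (Z j) = D)"

(* T is independent of the whole sequence, i.e. of the random element (Z 1, Z 2, ...) of the
   product space; the library's indep_var would force both variables to have the same type. *)
definition indep_of_seq :: "'a measure \<Rightarrow> ('a \<Rightarrow> nat) \<Rightarrow> (nat \<Rightarrow> 'a \<Rightarrow> nat) \<Rightarrow> bool" where
  "indep_of_seq \<Omega> T Z \<longleftrightarrow>
     prob_space.indep_set \<Omega>
       {T -` A \<inter> space \<Omega> | A. A \<in> sets (count_space UNIV)}
       {(\<lambda>\<omega>. \<lambda>j\<in>{1..}. Z j \<omega>) -` B \<inter> space \<Omega> | B.
          B \<in> sets (\<Pi>\<^sub>M j\<in>{1..}. count_space UNIV)}"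

(* The library's weak_conv_m is restricted to sequences; this is the same notion along an
   arbitrary filter, phrased for random variables that may live on different spaces. *)
definition converges_in_law ::
  "('i \<Rightarrow> 'a measure) \<Rightarrow> ('i \<Rightarrow> 'a \<Rightarrow> real) \<Rightarrow> 'b measure \<Rightarrow> ('b \<Rightarrow> real) \<Rightarrow> 'i filter \<Rightarrow> bool" where
  "converges_in_law \<Omega> Z \<Omega>' Z' F \<longleftrightarrow>
     (\<forall>x. isCont (cdf (distr \<Omega>' borel Z')) x \<longrightarrow>
        ((\<lambda>i. cdf (distr (\<Omega> i) borel (Z i)) x) \<longlongrightarrow> cdf (distr \<Omega>' borel Z') x) F)"

lemma converges_in_law_sequentially_iff:
  "converges_in_law \<Omega> Z \<Omega>' Z' sequentially \<longleftrightarrow>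
     weak_conv_m (\<lambda>n. distr (\<Omega> n) borel (Z n)) (distr \<Omega>' borel Z')"
  by (simp add: converges_in_law_def weak_conv_m_def weak_conv_def)

end

theory Submission imports Defs begin

text \<open>
  With \<open>P\<close> the generating function of \<open>M\<close> and \<open>b = p powr (1 / \<alpha>)\<close>, the generating function of \<open>S\<close>
  is \<open>p u / (1 - (1 - p) u) = u / ((1 - u) / p + u)\<close> where \<open>u = P (1 - b (1 - s))\<close>. Since
  \<open>(b (1 - s)) powr \<alpha> = p (1 - s) powr \<alpha>\<close>, the hypothesis on \<open>P\<close> at \<open>1\<close> says precisely that
  \<open>(1 - u) / p\<close> tends to \<open>c (1 - s) powr \<alpha>\<close>, so the generating functions converge to the one of
  DML. That the limit is the generating function of a law, and that convergence in law follows, is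
  the continuity theorem for generating functions; it is proved along an arbitrary filter, without
  subsequences, by showing successively that each coefficient is Cauchy.
\<close>

section \<open>Generating functions of random sums\<close>

text \<open>Dominated convergence: the partial sums equal \<open>W\<close> where
  \<open>T < m\<close> and 0 elsewhere. It serves both to expand a generating function into point
  masses and to split a random sum by its number of terms.\<close>

lemma (in prob_space) sums_integral_fibres:
  fixes T :: "'a \<Rightarrow> nat" and W :: "'a \<Rightarrow> real"
  assumes [measurable]: "T \<in> measurable M (count_space UNIV)" "W \<in> borel_measurable M"
    and W: "\<And>\<omega>. \<bar>W \<omega>\<bar> \<le> 1"
  shows "(\<lambda>n. \<integral>\<omega>. indicator {n} (T \<omega>) * W \<omega> \<partial>M) sums (\<integral>\<omega>. W \<omega> \<partial>M)"
proof -
  have [measurable]: "(\<lambda>\<omega>. indicator {n} (T \<omega>) :: real) \<in> borel_measurable M" for n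
    by (rule measurable_compose[OF assms(1)]) simp
  have int: "integrable M (\<lambda>\<omega>. indicator {n} (T \<omega>) * W \<omega>)" for n
    by (rule integrable_const_bound[where B = 1])
       (auto simp: abs_mult W split: split_indicator)
  have fibres: "(\<Sum>n<m. indicator {n} t * w) = (if t < m then w else 0)" for m t :: nat and w :: real
    by (induction m) (auto simp: indicator_def less_Suc_eq)
  have "(\<lambda>m. \<integral>\<omega>. (\<Sum>n<m. indicator {n} (T \<omega>) * W \<omega>) \<partial>M) \<longlonglongrightarrow> (\<integral>\<omega>. W \<omega> \<partial>M)"
  proof (rule integral_dominated_convergence[where w = "\<lambda>_. 1"])
    show "AE \<omega> in M. (\<lambda>m. \<Sum>n<m. indicator {n} (T \<omega>) * W \<omega>) \<longlonglongrightarrow> W \<omega>"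
    proof (intro AE_I2 tendsto_eventually)
      show "\<forall>\<^sub>F m in sequentially. (\<Sum>n<m. indicator {n} (T \<omega>) * W \<omega>) = W \<omega>" for \<omega>
        using eventually_gt_at_top[of "T \<omega>"] by eventually_elim (simp add: fibres)
    qed
  qed (auto simp: fibres W)
  then show ?thesis
    unfolding sums_def by (subst (asm) Bochner_Integration.integral_sum) (rule int)
qed

lemma (in prob_space) pgf_sums:
  assumes [measurable]: "Z \<in> measurable M (count_space UNIV)" and s: "\<bar>s\<bar> \<le> 1"
  shows "(\<lambda>k. prob (Z -` {k} \<inter> space M) * s ^ k) sums pgf M Z s"
proof -
  have "(\<lambda>k. \<integral>\<omega>. indicator {k} (Z \<omega>) * s ^ Z \<omega> \<partial>M) sums pgf M Z s"
    unfolding pgf_def by (rule sums_integral_fibres) (use s in \<open>auto simp: power_abs power_le_one\<close>)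
  moreover have "(\<integral>\<omega>. indicator {k} (Z \<omega>) * s ^ Z \<omega> \<partial>M) = prob (Z -` {k} \<inter> space M) * s ^ k" for k
  proof -
    have "(\<integral>\<omega>. indicator {k} (Z \<omega>) * s ^ Z \<omega> \<partial>M)
      = (\<integral>\<omega>. indicator (Z -` {k} \<inter> space M) \<omega> * s ^ k \<partial>M)"
      by (rule Bochner_Integration.integral_cong) (auto split: split_indicator)
    then show ?thesis by simp
  qed
  ultimately show ?thesis by simp
qed

lemma (in prob_space) abs_pgf_le_1:
  assumes [measurable]: "Z \<in> measurable M (count_space UNIV)" and s: "\<bar>s\<bar> \<le> 1"
  shows "\<bar>pgf M Z s\<bar> \<le> 1"
proof -
  have "\<bar>pgf M Z s\<bar> \<le> (\<integral>\<omega>. \<bar>s ^ Z \<omega>\<bar> \<partial>M)"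
    unfolding pgf_def by (rule integral_abs_bound)
  also have "\<dots> \<le> (\<integral>\<omega>. 1 \<partial>M)"
    using s by (intro integral_mono integrable_const_bound[where B = 1])
      (auto simp: power_abs power_le_one)
  finally show ?thesis by (simp add: prob_space)
qed

lemma pgf_eq_distr:
  assumes [measurable]: "Z \<in> measurable M (count_space UNIV)"
  shows "pgf M Z s = pgf (distr M (count_space UNIV) Z) (\<lambda>n. n) s"
  unfolding pgf_def by (subst integral_distr) auto

text \<open>Every event about \<open>g (T \<omega>)\<close> is an event about \<open>T\<close>,
  likewise for \<open>f\<close> and the sequence, so independence passes to these smaller families.
  The maps \<open>g\<close> and \<open>f\<close> bring both sides to a common element type, as
  \<open>indep_var\<close> demands.\<close>

lemma (in prob_space) indep_of_seq_indep_var: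
  assumes T: "T \<in> measurable M (count_space UNIV)"
    and Z: "\<And>j. j \<ge> 1 \<Longrightarrow> Z j \<in> measurable M (count_space UNIV)"
    and ind: "indep_of_seq M T Z"
    and g: "g \<in> measurable (count_space UNIV) N"
    and f: "f \<in> measurable (\<Pi>\<^sub>M j\<in>{1..}. count_space UNIV) N'"
  shows "indep_var N (\<lambda>\<omega>. g (T \<omega>)) N' (\<lambda>\<omega>. f (\<lambda>j\<in>{1..}. Z j \<omega>))"
  unfolding indep_var_eq
proof (intro conjI indep_set_sigma_sets)
  let ?Z = "\<lambda>\<omega>. \<lambda>j\<in>{1..}. Z j \<omega>"
  have Zm: "?Z \<in> measurable M (\<Pi>\<^sub>M j\<in>{1..}. count_space UNIV)"
    by (rule measurable_restrict) (use Z in auto)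
  show "(\<lambda>\<omega>. g (T \<omega>)) \<in> measurable M N"
    by (rule measurable_compose[OF T g])
  show "(\<lambda>\<omega>. f (?Z \<omega>)) \<in> measurable M N'"
    by (rule measurable_compose[OF Zm f])
  have stable: "Int_stable {h -` A \<inter> space M | A. A \<in> sets L}" for h :: "'a \<Rightarrow> 'd" and L
  proof (rule Int_stableI, safe)
    fix A B assume "A \<in> sets L" "B \<in> sets L"
    then show "\<exists>C. (h -` A \<inter> space M) \<inter> (h -` B \<inter> space M) = h -` C \<inter> space M \<and> C \<in> sets L"
      by (intro exI[of _ "A \<inter> B"]) auto
  qed
  show "Int_stable {(\<lambda>\<omega>. g (T \<omega>)) -` A \<inter> space M |A. A \<in> sets N}"
    "Int_stable {(\<lambda>\<omega>. f (?Z \<omega>)) -` A \<inter> space M |A. A \<in> sets N'}"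
    by (rule stable)+
  have "(\<lambda>\<omega>. g (T \<omega>)) -` A \<inter> space M = T -` (g -` A) \<inter> space M" for A
    by auto
  then have sub1: "{(\<lambda>\<omega>. g (T \<omega>)) -` A \<inter> space M |A. A \<in> sets N}
      \<subseteq> {T -` A \<inter> space M |A. A \<in> sets (count_space UNIV)}"
    by auto
  have "(\<lambda>\<omega>. f (?Z \<omega>)) -` A \<inter> space M
      = ?Z -` (f -` A \<inter> space (\<Pi>\<^sub>M j\<in>{1..}. count_space UNIV)) \<inter> space M" for A
    using measurable_space[OF Zm] by auto
  then have sub2: "{(\<lambda>\<omega>. f (?Z \<omega>)) -` A \<inter> space M |A. A \<in> sets N'}
      \<subseteq> {?Z -` A \<inter> space M |A. A \<in> sets (\<Pi>\<^sub>M j\<in>{1..}. count_space UNIV)}"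
    using measurable_sets[OF f] by blast
  show "indep_set {(\<lambda>\<omega>. g (T \<omega>)) -` A \<inter> space M |A. A \<in> sets N}
      {(\<lambda>\<omega>. f (?Z \<omega>)) -` A \<inter> space M |A. A \<in> sets N'}"
    using ind sub1 sub2 unfolding indep_of_seq_def indep_sets2_eq
    by (meson subset_iff subset_trans)
qed

lemma (in prob_space) iid_seq_measurable:
  "iid_seq M Z D \<Longrightarrow> j \<ge> 1 \<Longrightarrow> Z j \<in> measurable M (count_space UNIV)"
  by (auto simp: iid_seq_def indep_vars_def2)

lemma (in prob_space) measurable_random_sum:
  fixes T :: "'a \<Rightarrow> nat" and Z :: "nat \<Rightarrow> 'a \<Rightarrow> nat"
  assumes T: "T \<in> measurable M (count_space UNIV)" and Z: "iid_seq M Z D"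
  shows "(\<lambda>\<omega>. \<Sum>j=1..T \<omega>. Z j \<omega>) \<in> measurable M (count_space UNIV)"
proof (rule measurable_compose_countable[OF _ T])
  fix n
  show "(\<lambda>\<omega>. \<Sum>j=1..n. Z j \<omega>) \<in> measurable M (count_space UNIV)"
  proof (induction n)
    case (Suc n)
    \<comment> \<open>For each fixed value of the partial sum the total is measurable in \<omega>;
      the countably many values are then glued together.\<close>
    have "(\<lambda>\<omega>. (\<Sum>j=1..n. Z j \<omega>) + Z (Suc n) \<omega>) \<in> measurable M (count_space UNIV)"
      by (rule measurable_compose_countable[where f = "\<lambda>m \<omega>. m + Z (Suc n) \<omega>", OF _ Suc])
         (rule measurable_compose[OF iid_seq_measurable[OF Z]], auto)
    then show ?case by simp
  qed simp
qed

text \<open>On the event that \<open>T\<close> equals \<open>n\<close> the sum has fixed length, so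
  independence gives its contribution as the probability of that event times the \<open>n\<close>-th
  power of the generating function of \<open>D\<close>. Summing over \<open>n\<close> yields the
  generating function of \<open>T\<close> at that value.\<close>

lemma (in prob_space) pgf_random_sum:
  assumes T[measurable]: "T \<in> measurable M (count_space UNIV)"
    and Z: "iid_seq M Z D" and ind: "indep_of_seq M T Z" and s: "\<bar>s\<bar> \<le> 1"
  shows "pgf M (\<lambda>\<omega>. \<Sum>j=1..T \<omega>. Z j \<omega>) s = pgf M T (pgf D (\<lambda>n. n) s)"
proof -
  let ?\<Pi> = "\<Pi>\<^sub>M j\<in>{1::nat..}. count_space (UNIV :: nat set)"
  note [measurable] = measurable_random_sum[OF T Z]
  have Zm[measurable]: "Z j \<in> measurable M (count_space UNIV)" if "j \<ge> 1" for j
    using iid_seq_measurable[OF Z that] .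
  have [measurable]: "(\<lambda>\<omega>. indicator {n} (T \<omega>) :: real) \<in> borel_measurable M" for n
    by (rule measurable_compose[OF T]) simp
  have pow_le: "\<bar>s ^ n\<bar> \<le> 1" for n
    using s by (simp add: power_abs power_le_one)
  have pgfZ: "pgf M (Z j) s = pgf D (\<lambda>n. n) s" if "j \<ge> 1" for j
    using Z that by (subst pgf_eq_distr) (auto simp: iid_seq_def)
  have prod: "(\<integral>\<omega>. (\<Prod>j=1..n. s ^ Z j \<omega>) \<partial>M) = pgf D (\<lambda>n. n) s ^ n" for n
  proof -
    have "indep_vars (\<lambda>_. borel) (\<lambda>j. (\<lambda>m. s ^ m) \<circ> Z j) {1..n}"
    proof (rule indep_vars_compose)
      show "indep_vars (\<lambda>_. count_space UNIV) Z {1..n}"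
        using Z by (auto simp: iid_seq_def intro: indep_vars_subset)
    qed auto
    then have "(\<integral>\<omega>. (\<Prod>j=1..n. s ^ Z j \<omega>) \<partial>M) = (\<Prod>j=1..n. pgf M (Z j) s)"
      unfolding pgf_def
      by (intro indep_vars_lebesgue_integral integrable_const_bound[where B = 1])
         (auto simp: o_def pow_le)
    then show ?thesis by (simp add: pgfZ)
  qed
  have fibre: "(\<integral>\<omega>. indicator {n} (T \<omega>) * s ^ (\<Sum>j=1..T \<omega>. Z j \<omega>) \<partial>M)
      = prob (T -` {n} \<inter> space M) * pgf D (\<lambda>n. n) s ^ n" for n
  proof -
    have "(\<lambda>f. \<Prod>j=1..n. s ^ f j) \<in> borel_measurable ?\<Pi>"
    proof (rule borel_measurable_prod)
      fix j assume "j \<in> {1..n}"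
      then have [measurable]: "(\<lambda>f. f j) \<in> measurable ?\<Pi> (count_space UNIV)"
        by (intro measurable_component_singleton) auto
      show "(\<lambda>f. s ^ f j) \<in> borel_measurable ?\<Pi>" by measurable
    qed
    then have "indep_var borel (\<lambda>\<omega>. indicator {n} (T \<omega>) :: real)
        borel (\<lambda>\<omega>. \<Prod>j=1..n. s ^ (\<lambda>j\<in>{1..}. Z j \<omega>) j)"
      by (intro indep_of_seq_indep_var[OF T Zm ind]) auto
    \<comment> \<open>The indices \<open>1..n\<close> lie in \<open>{1..}\<close>, so the default
      value of the restricted function never enters the product.\<close>
    then have indep: "indep_var borel (\<lambda>\<omega>. indicator {n} (T \<omega>) :: real)
        borel (\<lambda>\<omega>. \<Prod>j=1..n. s ^ Z j \<omega>)"
      by (simp cong: prod.cong_simp)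
    have "(\<integral>\<omega>. indicator {n} (T \<omega>) * s ^ (\<Sum>j=1..T \<omega>. Z j \<omega>) \<partial>M)
        = (\<integral>\<omega>. indicator {n} (T \<omega>) * (\<Prod>j=1..n. s ^ Z j \<omega>) \<partial>M)"
      by (rule Bochner_Integration.integral_cong) (auto simp: power_sum split: split_indicator)
    also have "\<dots> = (\<integral>\<omega>. indicator {n} (T \<omega>) \<partial>M) * (\<integral>\<omega>. (\<Prod>j=1..n. s ^ Z j \<omega>) \<partial>M)"
    proof (rule indep_var_lebesgue_integral[OF indep])
      show "integrable M (\<lambda>\<omega>. indicator {n} (T \<omega>) :: real)"
        by (rule integrable_const_bound[where B = 1]) (auto split: split_indicator)
      show "integrable M (\<lambda>\<omega>. \<Prod>j=1..n. s ^ Z j \<omega>)"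
        using indep_var_rv2[OF indep] pow_le
        by (intro integrable_const_bound[where B = 1]) (auto simp: abs_prod intro!: prod_le_1)
    qed
    also have "(\<integral>\<omega>. indicator {n} (T \<omega>) \<partial>M) = (\<integral>\<omega>. indicator (T -` {n} \<inter> space M) \<omega> \<partial>M)"
      by (rule Bochner_Integration.integral_cong) (auto split: split_indicator)
    finally show ?thesis using prod[of n] by simp
  qed
  \<comment> \<open>This puts the inner value in the range where the generating function of
    \<open>T\<close> equals its power series.\<close>
  have "\<bar>pgf D (\<lambda>n. n) s\<bar> \<le> 1"
    using abs_pgf_le_1[OF Zm s, of 1] by (simp add: pgfZ)
  then have "(\<lambda>n. prob (T -` {n} \<inter> space M) * pgf D (\<lambda>n. n) s ^ n) sums pgf M T (pgf D (\<lambda>n. n) s)"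
    by (rule pgf_sums[OF T])
  moreover have "(\<lambda>n. prob (T -` {n} \<inter> space M) * pgf D (\<lambda>n. n) s ^ n)
      sums pgf M (\<lambda>\<omega>. \<Sum>j=1..T \<omega>. Z j \<omega>) s"
    unfolding pgf_def[of M "\<lambda>\<omega>. \<Sum>j=1..T \<omega>. Z j \<omega>"] fibre[symmetric]
    by (rule sums_integral_fibres) (auto simp: pow_le)
  ultimately show ?thesis by (rule sums_unique2[symmetric])
qed

section \<open>The continuity theorem for generating functions\<close>

text \<open>Closeness to a convergent function, which may change with \<open>e\<close>, makes
  \<open>x\<close> Cauchy along the filter, and completeness supplies the limit.\<close>

lemma tendsto_uniform_approx:
  fixes x :: "'i \<Rightarrow> 'a :: complete_space"
  assumes approx: "\<And>e. e > 0 \<Longrightarrow> \<exists>f l. (f \<longlongrightarrow> l) F \<and> (\<forall>\<^sub>F i in F. dist (f i) (x i) < e)"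
    and F: "F \<noteq> bot"
  shows "\<exists>l. (x \<longlongrightarrow> l) F"
proof -
  have "cauchy_filter (filtermap x F)"
    unfolding cauchy_filter_metric_filtermap
  proof (intro allI impI)
    fix e :: real assume "e > 0"
    \<comment> \<open>With \<open>e / 4\<close> from \<open>x\<close> to \<open>f\<close> and
      \<open>e / 4\<close> from \<open>f\<close> to \<open>l\<close>, each value of \<open>x\<close>
      is within \<open>e / 2\<close> of \<open>l\<close>, hence any two are within \<open>e\<close>
      of each other.\<close>
    then obtain f l where f: "(f \<longlongrightarrow> l) F" "\<forall>\<^sub>F i in F. dist (f i) (x i) < e / 4"
      using approx[of "e / 4"] by auto
    have "\<forall>\<^sub>F i in F. dist (x i) l < e / 2"
      using f(2) tendstoD[OF f(1), of "e / 4", simplified, OF \<open>e > 0\<close>]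
    proof eventually_elim
      case (elim i)
      then show ?case using dist_triangle3[of "x i" l "f i"] by simp
    qed
    then show "\<exists>P. eventually P F \<and> (\<forall>i j. P i \<and> P j \<longrightarrow> dist (x i) (x j) < e)"
      by (intro exI[of _ "\<lambda>i. dist (x i) l < e / 2"])
         (auto intro: dist_triangle_half_l)
  qed
  then show ?thesis
    using F complete_uniform[where S = "UNIV :: 'a set"] complete_UNIV
    by (force simp: filterlim_def filtermap_bot_iff)
qed

text \<open>After dropping the terms below \<open>n\<close> and dividing by \<open>s ^ n\<close>,
  what remains beyond \<open>a n\<close> is \<open>s\<close> times a series dominated by the
  geometric one. The bound is independent of \<open>a\<close>, so a small \<open>s\<close> recovers
  coefficient \<open>n\<close> uniformly.\<close>

lemma power_series_tail_le:
  fixes a :: "nat \<Rightarrow> real"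
  assumes a: "\<And>k. 0 \<le> a k" "\<And>k. a k \<le> 1" and s: "0 < s" "s < 1"
  shows "\<bar>((\<Sum>k. a k * s ^ k) - (\<Sum>j<n. a j * s ^ j)) / s ^ n - a n\<bar> \<le> s / (1 - s)"
proof -
  have sm: "summable (\<lambda>k. a k * s ^ k)"
    using a s by (intro summable_comparison_test'[OF summable_geometric[of s], of 0])
      (auto simp: abs_mult mult_left_le_one_le)
  have sm': "summable (\<lambda>k. a (k + Suc n) * s ^ k)"
    using a s by (intro summable_comparison_test'[OF summable_geometric[of s], of 0])
      (auto simp: abs_mult mult_left_le_one_le)
  have "(\<Sum>k. a k * s ^ k) = (\<Sum>k. a (k + Suc n) * s ^ (k + Suc n)) + (\<Sum>j<Suc n. a j * s ^ j)"
    by (rule suminf_split_initial_segment[OF sm])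
  also have "(\<Sum>k. a (k + Suc n) * s ^ (k + Suc n)) = s ^ Suc n * (\<Sum>k. a (k + Suc n) * s ^ k)"
    using suminf_mult[OF sm', of "s ^ Suc n"] by (simp add: power_add mult_ac)
  finally have "((\<Sum>k. a k * s ^ k) - (\<Sum>j<n. a j * s ^ j)) / s ^ n - a n
      = s * (\<Sum>k. a (k + Suc n) * s ^ k)"
    using s by (simp add: field_simps)
  moreover have "(\<Sum>k. a (k + Suc n) * s ^ k) \<le> (\<Sum>k. s ^ k)"
    using a s by (intro suminf_le sm') (auto simp: mult_left_le_one_le)
  then have "(\<Sum>k. a (k + Suc n) * s ^ k) \<le> 1 / (1 - s)"
    using s by (simp add: suminf_geometric)
  then have "s * (\<Sum>k. a (k + Suc n) * s ^ k) \<le> s * (1 / (1 - s))"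
    using s by (intro mult_left_mono) auto
  moreover have "0 \<le> (\<Sum>k. a (k + Suc n) * s ^ k)"
    using a s by (intro suminf_nonneg sm') auto
  ultimately show ?thesis using s by simp
qed

text \<open>By strong induction, coefficient \<open>n\<close> is uniformly close to an expression in
  the series at one small \<open>s\<close> and the earlier coefficients, all of which
  converge.\<close>

lemma coefficients_tendsto:
  fixes a :: "'i \<Rightarrow> nat \<Rightarrow> real" and G :: "real \<Rightarrow> real"
  assumes F: "F \<noteq> bot"
    and a: "\<forall>\<^sub>F i in F. \<forall>k. 0 \<le> a i k \<and> a i k \<le> 1"
    and G: "\<And>s. 0 < s \<Longrightarrow> s < 1 \<Longrightarrow> ((\<lambda>i. \<Sum>k. a i k * s ^ k) \<longlongrightarrow> G s) F"
  shows "\<exists>l. ((\<lambda>i. a i n) \<longlongrightarrow> l) F"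
proof (induction n rule: less_induct)
  case (less n)
  then obtain b where b: "\<And>j. j < n \<Longrightarrow> ((\<lambda>i. a i j) \<longlongrightarrow> b j) F" by metis
  show ?case
  proof (rule tendsto_uniform_approx[OF _ F])
    fix e :: real assume e: "e > 0"
    \<comment> \<open>Chosen so that \<open>s / (1 - s) = e / (2 + e)\<close>, which is below
      \<open>e\<close>.\<close>
    define s where "s = e / (2 + 2 * e)"
    have s: "0 < s" "s < 1" and "s / (1 - s) < e"
      using e by (auto simp: s_def field_simps add_pos_pos)
    let ?f = "\<lambda>i. ((\<Sum>k. a i k * s ^ k) - (\<Sum>j<n. a i j * s ^ j)) / s ^ n"
    have "(?f \<longlongrightarrow> (G s - (\<Sum>j<n. b j * s ^ j)) / s ^ n) F"
      using s b by (intro tendsto_intros G) auto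
    moreover have "\<forall>\<^sub>F i in F. dist (?f i) (a i n) < e"
      using a
    proof eventually_elim
      case (elim i)
      have "\<bar>?f i - a i n\<bar> \<le> s / (1 - s)"
        using elim s by (intro power_series_tail_le) auto
      with \<open>s / (1 - s) < e\<close> show ?case by (simp add: dist_real_def)
    qed
    ultimately show "\<exists>f l. (f \<longlongrightarrow> l) F \<and> (\<forall>\<^sub>F i in F. dist (f i) (a i n) < e)" by blast
  qed
qed

text \<open>Absolute summability gives uniform convergence up to and including the endpoints; the
  endpoint 1 is where the total mass is read off.\<close>

lemma continuous_on_power_series_Icc:
  fixes a :: "nat \<Rightarrow> real"
  assumes "summable (\<lambda>k. \<bar>a k\<bar>)"
  shows "continuous_on {-1..1} (\<lambda>s. \<Sum>k. a k * s ^ k)"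
proof (rule uniform_limit_theorem)
  show "uniform_limit {-1..1} (\<lambda>n s. \<Sum>k<n. a k * s ^ k) (\<lambda>s. \<Sum>k. a k * s ^ k) sequentially"
    by (rule Weierstrass_m_test[OF _ assms])
       (auto simp: abs_mult power_abs intro!: mult_right_le_one_le power_le_one)
qed (auto intro!: always_eventually continuous_intros)

lemma pgf_pmf_eq_suminf:
  assumes "\<bar>s\<bar> \<le> 1"
  shows "pgf (measure_pmf D) (\<lambda>n. n) s = (\<Sum>k. pmf D k * s ^ k)"
  using measure_pmf.pgf_sums[OF _ assms, of "\<lambda>n. n" D] by (simp add: sums_iff pmf.rep_eq vimage_def)

text \<open>The limits of the coefficients form a subprobability whose series agrees with
  \<open>G\<close> inside the interval. Continuity of \<open>G\<close> up to 1 together with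
  \<open>G 1 = 1\<close> excludes escape of mass, so they form a probability mass function.\<close>

lemma pgf_continuity:
  fixes a :: "'i \<Rightarrow> nat \<Rightarrow> real" and G :: "real \<Rightarrow> real"
  assumes F: "F \<noteq> bot"
    and a: "\<forall>\<^sub>F i in F. (\<forall>k. 0 \<le> a i k) \<and> a i sums 1"
    and G: "\<And>s. \<bar>s\<bar> < 1 \<Longrightarrow> ((\<lambda>i. \<Sum>k. a i k * s ^ k) \<longlongrightarrow> G s) F"
    and cont: "continuous_on {-1..1} G" and G1: "G 1 = 1"
  shows "\<exists>D. (\<forall>k. ((\<lambda>i. a i k) \<longlongrightarrow> pmf D k) F) \<and>
    (\<forall>s. \<bar>s\<bar> \<le> 1 \<longrightarrow> pgf (measure_pmf D) (\<lambda>n. n) s = G s)"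
proof -
  have partial: "\<forall>\<^sub>F i in F. \<forall>K. finite K \<longrightarrow> (\<Sum>k\<in>K. a i k) \<le> 1"
    using a by eventually_elim (metis sum_le_suminf sums_iff)
  have a1: "\<forall>\<^sub>F i in F. \<forall>k. 0 \<le> a i k \<and> a i k \<le> 1"
    using a partial by eventually_elim (metis finite.emptyI finite_insert sum.empty sum.insert empty_iff add_0_right)
  have "\<exists>b. \<forall>k. ((\<lambda>i. a i k) \<longlongrightarrow> b k) F"
    using coefficients_tendsto[OF F a1, of G] G by (intro choice allI) auto
  then obtain b where b: "\<And>k. ((\<lambda>i. a i k) \<longlongrightarrow> b k) F" by auto
  have b0: "0 \<le> b k" for k
    by (rule tendsto_lowerbound[OF b _ F]) (use a in \<open>auto elim: eventually_mono\<close>)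
  have "(\<Sum>k<n. b k) \<le> 1" for n
    by (rule tendsto_upperbound[OF tendsto_sum[OF b] _ F])
       (use partial in \<open>auto elim: eventually_mono\<close>)
  then have sb: "summable b"
    by (intro summableI_nonneg_bounded[where x = 1] b0)
  have inner: "(\<Sum>k. b k * s ^ k) = G s" if s: "\<bar>s\<bar> < 1" for s
  proof -
    \<comment> \<open>Limit and sum are exchanged with the dominating series of
      \<open>\<bar>s\<bar> ^ k\<close>, which is summable because \<open>s\<close> is strictly
      inside the interval.\<close>
    have "((\<lambda>i. \<Sum>k. a i k * s ^ k) \<longlongrightarrow> (\<Sum>k. b k * s ^ k)) F"
    proof (rule tannerys_theorem[THEN conjunct2, THEN conjunct2])
      show "((\<lambda>i. a i k * s ^ k) \<longlongrightarrow> b k * s ^ k) F" for k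
        by (intro tendsto_intros b)
      show "\<forall>\<^sub>F (k, i) in sequentially \<times>\<^sub>F F. norm (a i k * s ^ k) \<le> \<bar>s\<bar> ^ k"
        by (rule eventually_prodI[THEN eventually_mono, OF eventually_True a1])
           (auto simp: abs_mult power_abs mult_left_le_one_le)
      show "summable (\<lambda>k. \<bar>s\<bar> ^ k)" using s by (simp add: summable_geometric)
    qed (rule F)
    then show ?thesis using tendsto_unique[OF F _ G[OF s]] by auto
  qed
  have outer: "(\<Sum>k. b k * s ^ k) = G s" if s: "\<bar>s\<bar> \<le> 1" for s
  proof -
    have cl: "closure {-1<..<1} = {-1..1::real}" by (simp add: closure_greaterThanLessThan)
    \<comment> \<open>The difference is continuous on the closed interval and vanishes on its
      interior, hence also at the endpoints.\<close>
    have "(\<Sum>k. b k * s ^ k) - G s = 0"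
    proof (rule continuous_constant_on_closure[where S = "{-1<..<1}" and x = s])
      show "continuous_on (closure {-1<..<1}) (\<lambda>s. (\<Sum>k. b k * s ^ k) - G s)"
        unfolding cl using sb b0
        by (intro continuous_on_diff continuous_on_power_series_Icc cont) auto
    qed (use s cl in \<open>auto simp: inner\<close>)
    then show ?thesis by simp
  qed
  have "suminf b = 1"
    using outer[of 1] G1 by simp
  then have "(\<integral>\<^sup>+k. ennreal (b k) \<partial>count_space UNIV) = 1"
    by (simp add: nn_integral_count_space_nat suminf_ennreal2 sb b0)
  then have pmf: "pmf (embed_pmf b) k = b k" for k
    by (intro pmf_embed_pmf b0)
  show ?thesis
    using b outer by (intro exI[of _ "embed_pmf b"]) (simp add: pmf pgf_pmf_eq_suminf)
qed

section \<open>Distribution functions and the limit of the thinned generating function\<close>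

text \<open>Only finitely many naturals lie below \<open>x\<close>, so convergence of point masses
  carries over to distribution functions through a finite sum.\<close>

lemma (in prob_space) cdf_distr_real_of_nat:
  assumes [measurable]: "Z \<in> measurable M (count_space UNIV)"
  shows "cdf (distr M borel (\<lambda>\<omega>. real (Z \<omega>))) x
    = (\<Sum>k | real k \<le> x. prob (Z -` {k} \<inter> space M))"
proof -
  have fin: "finite {k. real k \<le> x}"
    by (rule finite_subset[of _ "{..nat \<lfloor>x\<rfloor>}"]) (auto simp: le_nat_floor)
  have "cdf (distr M borel (\<lambda>\<omega>. real (Z \<omega>))) x = prob (\<Union>k\<in>{k. real k \<le> x}. Z -` {k} \<inter> space M)"
    unfolding cdf_def by (subst measure_distr) (auto intro!: arg_cong[where f = prob])
  also have "\<dots> = (\<Sum>k | real k \<le> x. prob (Z -` {k} \<inter> space M))"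
    using fin by (intro finite_measure_finite_Union) (auto simp: disjoint_family_on_def)
  finally show ?thesis .
qed

lemma pgf_bernoulli:
  assumes "0 \<le> b" "b \<le> 1"
  shows "pgf (measure_pmf (map_pmf of_bool (bernoulli_pmf b))) (\<lambda>n. n) s = 1 - b * (1 - s)"
  using assms by (simp add: pgf_def algebra_simps)

text \<open>Only the behaviour of \<open>P\<close> just to the left of 1 matters, so
  \<open>P\<close> is an arbitrary real function; \<open>s < 1\<close> keeps its argument strictly
  below 1, as the one-sided limit requires.\<close>

lemma geometric_thinned_pgf_tendsto:
  fixes P :: "real \<Rightarrow> real"
  assumes \<alpha>: "0 < \<alpha>"
    and P: "((\<lambda>s. (1 - P s) / (1 - s) powr \<alpha>) \<longlongrightarrow> c) (at_left 1)"
    and c: "0 < c" and s: "s < 1"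
  defines "u \<equiv> \<lambda>p. P (1 - p powr (1 / \<alpha>) * (1 - s))"
  shows "((\<lambda>p. p * u p / (1 - (1 - p) * u p)) \<longlongrightarrow> inverse (1 + c * (1 - s) powr \<alpha>)) (at_right 0)"
proof -
  let ?t = "\<lambda>p. 1 - p powr (1 / \<alpha>) * (1 - s)"
  have pos: "\<forall>\<^sub>F p in at_right 0. (0::real) < p"
    by (rule eventually_at_right_less)
  have "((\<lambda>p. p powr (1 / \<alpha>)) \<longlongrightarrow> 0) (at_right (0::real))"
    by (rule tendsto_zero_powrI[OF tendsto_ident_at tendsto_const])
       (use \<alpha> pos in \<open>auto elim: eventually_mono\<close>)
  then have "(?t \<longlongrightarrow> 1 - 0 * (1 - s)) (at_right 0)"
    by (intro tendsto_diff tendsto_mult tendsto_const)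
  then have "(?t \<longlongrightarrow> 1) (at_right 0)" by simp
  moreover have "\<forall>\<^sub>F p in at_right 0. ?t p \<in> {..<1} \<and> ?t p \<noteq> 1"
    using pos by eventually_elim (use s in auto)
  ultimately have "filterlim ?t (at_left 1) (at_right 0)"
    by (simp add: filterlim_at)
  then have "((\<lambda>p. (1 - u p) / (1 - ?t p) powr \<alpha>) \<longlongrightarrow> c) (at_right 0)"
    unfolding u_def by (rule filterlim_compose[OF P])
  then have "((\<lambda>p. (1 - u p) / (1 - ?t p) powr \<alpha> * (1 - s) powr \<alpha>) \<longlongrightarrow> c * (1 - s) powr \<alpha>) (at_right 0)"
    by (intro tendsto_intros)
  \<comment> \<open>Here \<open>1 - ?t p\<close> is \<open>p powr (1 / \<alpha>) * (1 - s)\<close>,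
    whose power \<alpha> is \<open>p * (1 - s) powr \<alpha>\<close>; the exponent
    \<open>1 / \<alpha>\<close> is made for this cancellation.\<close>
  moreover have "\<forall>\<^sub>F p in at_right 0.
      (1 - u p) / (1 - ?t p) powr \<alpha> * (1 - s) powr \<alpha> = (1 - u p) / p"
    using pos by eventually_elim (use s \<alpha> in \<open>simp add: powr_mult powr_powr\<close>)
  ultimately have slope: "((\<lambda>p. (1 - u p) / p) \<longlongrightarrow> c * (1 - s) powr \<alpha>) (at_right 0)"
    by (rule Lim_transform_eventually)
  then have "((\<lambda>p. 1 - p * ((1 - u p) / p)) \<longlongrightarrow> 1 - 0 * (c * (1 - s) powr \<alpha>)) (at_right 0)"
    by (intro tendsto_intros)
  moreover have "\<forall>\<^sub>F p in at_right 0. 1 - p * ((1 - u p) / p) = u p"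
    using pos by eventually_elim simp
  ultimately have u: "(u \<longlongrightarrow> 1) (at_right 0)"
    by (simp add: Lim_transform_eventually)
  have "c * (1 - s) powr \<alpha> + 1 > 0"
    using c by (simp add: add_nonneg_pos)
  then have "((\<lambda>p. u p / ((1 - u p) / p + u p)) \<longlongrightarrow> 1 / (c * (1 - s) powr \<alpha> + 1)) (at_right 0)"
    by (intro tendsto_intros slope u) simp
  \<comment> \<open>Numerator and denominator are divided by \<open>p\<close>, after writing
    \<open>1 - (1 - p) * u p\<close> as \<open>(1 - u p) + p * u p\<close>.\<close>
  moreover have "\<forall>\<^sub>F p in at_right 0. u p / ((1 - u p) / p + u p) = p * u p / (1 - (1 - p) * u p)"
    using pos
  proof eventually_elim
    case (elim p)
    then have "(1 - u p) / p + u p = (1 - (1 - p) * u p) / p"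
      by (simp add: field_simps)
    then show ?case using elim by simp
  qed
  ultimately show ?thesis
    by (simp add: Lim_transform_eventually inverse_eq_divide add.commute)
qed

section \<open>Convergence in law of the geometric sum\<close>

theorem theorem5p5:
  fixes \<Omega> :: "'a measure" and \<Omega>' :: "real \<Rightarrow> 'b measure"
    and \<alpha> c :: real
    and M :: "'a \<Rightarrow> nat" and Y :: "real \<Rightarrow> nat \<Rightarrow> 'a \<Rightarrow> nat" and X :: "real \<Rightarrow> 'a \<Rightarrow> nat"
    and Xs :: "real \<Rightarrow> nat \<Rightarrow> 'b \<Rightarrow> nat" and N :: "real \<Rightarrow> 'b \<Rightarrow> nat"
    and S :: "real \<Rightarrow> 'b \<Rightarrow> nat"
  assumes "0 < \<alpha>" and "\<alpha> \<le> 1"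
    and "prob_space \<Omega>"
    and "M \<in> measurable \<Omega> (count_space UNIV)"
    and "0 < c"
    and "((\<lambda>s. (1 - pgf \<Omega> M s) / (1 - s) powr \<alpha>) \<longlongrightarrow> c) (at_left 1)"
    and "\<And>p. 0 < p \<Longrightarrow> p < 1 \<Longrightarrow>
           iid_seq \<Omega> (Y p) (measure_pmf (map_pmf of_bool (bernoulli_pmf (p powr (1 / \<alpha>)))))"
    and "\<And>p. 0 < p \<Longrightarrow> p < 1 \<Longrightarrow> indep_of_seq \<Omega> M (Y p)"
    and "\<And>p \<omega>. 0 < p \<Longrightarrow> p < 1 \<Longrightarrow> X p \<omega> = (\<Sum>j=1..M \<omega>. Y p j \<omega>)"
    and "\<And>p. 0 < p \<Longrightarrow> p < 1 \<Longrightarrow> prob_space (\<Omega>' p)"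
    and "\<And>p. 0 < p \<Longrightarrow> p < 1 \<Longrightarrow>
           iid_seq (\<Omega>' p) (Xs p) (distr \<Omega> (count_space UNIV) (X p))"
    and "\<And>p. 0 < p \<Longrightarrow> p < 1 \<Longrightarrow> geometric_var (\<Omega>' p) (N p) p"
    and "\<And>p. 0 < p \<Longrightarrow> p < 1 \<Longrightarrow> indep_of_seq (\<Omega>' p) (N p) (Xs p)"
    and "\<And>p \<omega>. 0 < p \<Longrightarrow> p < 1 \<Longrightarrow> S p \<omega> = (\<Sum>i=1..N p \<omega>. Xs p i \<omega>)"
  shows "\<exists>D :: nat pmf. DML_var (measure_pmf D) (\<lambda>n. n) c \<alpha> \<and>
           converges_in_law \<Omega>' (\<lambda>p \<omega>. real (S p \<omega>)) (measure_pmf D) real (at_right 0)"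
proof -
  note \<alpha> = assms(1,2) and c = assms(5) and Y = assms(7) and X = assms(9)
    and Xs = assms(11) and N = assms(12) and S = assms(14)
  interpret \<Omega>: prob_space \<Omega> by fact
  let ?G = "\<lambda>s. inverse (1 + c * (1 - s) powr \<alpha>)"
  define a where "a p k = measure (\<Omega>' p) (S p -` {k} \<inter> space (\<Omega>' p))" for p k
  have p01: "\<forall>\<^sub>F p in at_right 0. 0 < p \<and> p < (1::real)"
    using eventually_at_right_real[of 0 1] by (auto elim: eventually_mono)
  have Sm: "S p \<in> measurable (\<Omega>' p) (count_space UNIV)" if p: "0 < p" "p < 1" for p
  proof -
    have "N p \<in> measurable (\<Omega>' p) (count_space UNIV)"
      using N[OF p] by (simp add: geometric_var_def)
    from prob_space.measurable_random_sum[OF assms(10)[OF p] this Xs[OF p]]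
    show ?thesis unfolding S[OF p, abs_def] .
  qed
  have pgfS: "pgf (\<Omega>' p) (S p) s
      = p * pgf \<Omega> M (1 - p powr (1 / \<alpha>) * (1 - s))
        / (1 - (1 - p) * pgf \<Omega> M (1 - p powr (1 / \<alpha>) * (1 - s)))"
    if p: "0 < p" "p < 1" and s: "\<bar>s\<bar> \<le> 1" for p s
  proof -
    have X_eq: "X p = (\<lambda>\<omega>. \<Sum>j=1..M \<omega>. Y p j \<omega>)" and S_eq: "S p = (\<lambda>\<omega>. \<Sum>i=1..N p \<omega>. Xs p i \<omega>)"
      using X[OF p] S[OF p] by auto
    have Xm: "X p \<in> measurable \<Omega> (count_space UNIV)"
      unfolding X_eq by (rule \<Omega>.measurable_random_sum[OF assms(4) Y[OF p]])
    have "p powr (1 / \<alpha>) \<le> 1"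
      using p \<alpha> by (intro powr_le1) auto
    then have u: "pgf \<Omega> (X p) s = pgf \<Omega> M (1 - p powr (1 / \<alpha>) * (1 - s))"
      unfolding X_eq
      by (subst \<Omega>.pgf_random_sum[OF assms(4) Y[OF p] assms(8)[OF p] s]) (simp add: pgf_bernoulli)
    \<comment> \<open>Second use of the random-sum formula: the first treated the Bernoulli thinning
      of \<open>M\<close>, this one the geometric number of copies of \<open>X p\<close>.\<close>
    have "pgf (\<Omega>' p) (S p) s = pgf (\<Omega>' p) (N p) (pgf \<Omega> (X p) s)"
      unfolding S_eq pgf_eq_distr[OF Xm]
      using N[OF p] by (intro prob_space.pgf_random_sum[OF assms(10)[OF p] _ Xs[OF p] assms(13)[OF p] s])
        (simp add: geometric_var_def)
    also have "\<dots> = p * pgf \<Omega> (X p) s / (1 - (1 - p) * pgf \<Omega> (X p) s)"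
      using N[OF p] \<Omega>.abs_pgf_le_1[OF Xm s] by (simp add: geometric_var_def)
    finally show ?thesis by (simp add: u)
  qed
  have a_sums: "(\<lambda>k. a p k * s ^ k) sums pgf (\<Omega>' p) (S p) s" if "0 < p" "p < 1" "\<bar>s\<bar> \<le> 1" for p s
    unfolding a_def by (intro prob_space.pgf_sums assms(10) Sm that)
  have "\<exists>D. (\<forall>k. ((\<lambda>p. a p k) \<longlongrightarrow> pmf D k) (at_right 0)) \<and>
      (\<forall>s. \<bar>s\<bar> \<le> 1 \<longrightarrow> pgf (measure_pmf D) (\<lambda>n. n) s = ?G s)"
  proof (rule pgf_continuity)
    show "\<forall>\<^sub>F p in at_right 0. (\<forall>k. 0 \<le> a p k) \<and> a p sums 1"
      using p01
    proof eventually_elim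
      case (elim p)
      interpret prob_space "\<Omega>' p" using elim by (intro assms(10)) auto
      have "a p sums 1" using a_sums[of p 1] elim by (simp add: pgf_def prob_space)
      then show ?case by (simp add: a_def)
    qed
    show "((\<lambda>p. \<Sum>k. a p k * s ^ k) \<longlongrightarrow> ?G s) (at_right 0)" if s: "\<bar>s\<bar> < 1" for s
    proof (rule Lim_transform_eventually)
      show "((\<lambda>p. p * pgf \<Omega> M (1 - p powr (1 / \<alpha>) * (1 - s))
        / (1 - (1 - p) * pgf \<Omega> M (1 - p powr (1 / \<alpha>) * (1 - s)))) \<longlongrightarrow> ?G s) (at_right 0)"
        using s by (intro geometric_thinned_pgf_tendsto \<alpha>(1) assms(6) c) simp
      show "\<forall>\<^sub>F p in at_right 0. p * pgf \<Omega> M (1 - p powr (1 / \<alpha>) * (1 - s))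
        / (1 - (1 - p) * pgf \<Omega> M (1 - p powr (1 / \<alpha>) * (1 - s))) = (\<Sum>k. a p k * s ^ k)"
        using p01
      proof eventually_elim
        case (elim p)
        then have "pgf (\<Omega>' p) (S p) s = (\<Sum>k. a p k * s ^ k)"
          using s by (intro sums_unique a_sums) auto
        then show ?case using pgfS[of p s] elim s by simp
      qed
    qed
    have "1 + c * (1 - s) powr \<alpha> > 0" for s
      using c by (intro add_pos_nonneg) auto
    then have pos: "1 + c * (1 - s) powr \<alpha> \<noteq> 0" for s
      by (metis less_irrefl)
    \<comment> \<open>The base vanishes at \<open>s = 1\<close>, where continuity rests on the
      positivity of \<alpha>.\<close>
    have "continuous_on {-1..1} (\<lambda>s. (1 - s) powr \<alpha>)"
    proof (rule continuous_on_powr')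
    qed (use \<alpha> in \<open>auto intro!: continuous_intros\<close>)
    then have "continuous_on {-1..1} (\<lambda>s. 1 + c * (1 - s) powr \<alpha>)"
      by (rule continuous_on_add[OF continuous_on_const continuous_on_mult_left])
    then show "continuous_on {-1..1} ?G"
      by (rule continuous_on_inverse) (simp add: pos)
  \<comment> \<open>What remains is that the filter is proper and that \<open>?G 1 = 1\<close>, the
    latter because \<open>0 powr \<alpha>\<close> is 0.\<close>
  qed auto
  then obtain D where "\<forall>k. ((\<lambda>p. a p k) \<longlongrightarrow> pmf D k) (at_right 0)"
    and "\<forall>s. \<bar>s\<bar> \<le> 1 \<longrightarrow> pgf (measure_pmf D) (\<lambda>n. n) s = ?G s" by (elim exE conjE)
  then have D: "\<And>k. ((\<lambda>p. a p k) \<longlongrightarrow> pmf D k) (at_right 0)"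
    and pgfD: "\<And>s. \<bar>s\<bar> \<le> 1 \<Longrightarrow> pgf (measure_pmf D) (\<lambda>n. n) s = ?G s" by simp_all
  have "DML_var (measure_pmf D) (\<lambda>n. n) c \<alpha>"
    using \<alpha> c pgfD by (simp add: DML_var_def)
  moreover have "converges_in_law \<Omega>' (\<lambda>p \<omega>. real (S p \<omega>)) (measure_pmf D) real (at_right 0)"
    unfolding converges_in_law_def
  \<comment> \<open>The distribution functions converge at every \<open>x\<close>, not only at
    continuity points of the limit.\<close>
  proof (intro allI impI, rule Lim_transform_eventually)
    fix x
    have "cdf (distr (measure_pmf D) borel real) x = (\<Sum>k | real k \<le> x. pmf D k)"
      using measure_pmf.cdf_distr_real_of_nat[of "\<lambda>n. n" D x] by (simp add: pmf.rep_eq vimage_def)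
    then show "((\<lambda>p. \<Sum>k | real k \<le> x. a p k) \<longlongrightarrow> cdf (distr (measure_pmf D) borel real) x) (at_right 0)"
      by (simp only: tendsto_sum D)
    show "\<forall>\<^sub>F p in at_right 0. (\<Sum>k | real k \<le> x. a p k)
        = cdf (distr (\<Omega>' p) borel (\<lambda>\<omega>. real (S p \<omega>))) x"
      using p01
    proof eventually_elim
      case (elim p)
      then show ?case
        unfolding a_def
        by (intro prob_space.cdf_distr_real_of_nat[symmetric] assms(10) Sm) auto
    qed
  qed
  ultimately show ?thesis by (intro exI conjI)
qed

end
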